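(* Let $n\ge2$, let $\Lambda_1,\dots,\Lambda_{n-1},T,w$ be positive integers, $\lambda$ an integer with $0\le\lambda<w$, and $N=\Lambda_1\Lambda_2\cdots\Lambda_{n-1}T$. Let $j\ge1$, let $i_1,\dots,i_j$ be distinct elements of $\{1,\dots,n-1\}$, and put $M=\Lambda_{i_1}\Lambda_{i_2}\cdots\Lambda_{i_j}$. Suppose that a $(\Lambda_1\times\cdots\times\Lambda_{n-1}\times T,w,0,\lambda)$ AMOPS$(i_1,\dots,i_j)$ OOC exists, and let $\Phi$ denote the largest size of such a code. Then $$\Phi\le\left\lfloor\frac{N}{Tw}\left\lfloor\frac{N\left(1-\frac1M\right)}{w-1}\left\lfloor\frac{N\left(1-\frac2M\right)}{w-2}\left\lfloor\cdots\left\lfloor\frac{N\left(1-\frac{\lambda}{M}\right)}{w-\lambda}\right\rfloor\cdots\right\rfloor\right\rfloor\right\rfloor\right\rfloor ,$$ and the right-hand side is at most $$\left\lfloor\frac{N}{Tw}\left\lfloor\frac{N-T}{w-1}\left\lfloor\frac{N-2T}{w-2}\left\lfloor\cdots\left\lfloor\frac{N-\lambda T}{w-\lambda}\right\rfloor\cdots\right\rfloor\right\rfloor\right\rfloor\right\rfloor .$$ In the extremal case $w=M$, the first bound equals $\dfrac{N^{\lambda+1}}{TM^{\lambda+1}}$. In particular (the case $j=1$), if a $(\Lambda_1\times\cdots\times\Lambda_{n-1}\times T,w,0,\lambda)$ AMOPS$(i)$ OOC exists and $\Phi$ denotes the largest size of such a code, then $$\Phi\le\left\lfloor\frac{N}{Tw}\left\lfloor\frac{N\left(1-\frac1{\Lambda_i}\right)}{w-1}\left\lfloor\frac{N\left(1-\frac2{\Lambda_i}\right)}{w-2}\left\lfloor\cdots\left\lfloor\frac{N\left(1-\frac{\lambda}{\Lambda_i}\right)}{w-\lambda}\right\rfloor\cdots\right\rfloor\right\rfloor\right\rfloor\right\rfloor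 ,$$ and in the extremal case $w=\Lambda_i$ this bound equals $T^{\lambda}\prod_{l\ne i}\Lambda_l^{\lambda+1}$, the product being over $l\in\{1,\dots,n-1\}\setminus\{i\}$.
   Context: An $n$-dimensional optical orthogonal code ($n$-D OOC) with parameters $(\Lambda_1\times\cdots\times\Lambda_{n-1}\times T,w,\lambda_a,\lambda_c)$ is a nonempty set $C$ of binary ($0/1$) arrays $A=(a_{i_1,\dots,i_n})$, indexed by $0\le i_s\le\Lambda_s-1$ for $1\le s\le n-1$ and $0\le i_n\le T-1$, called codewords, each having exactly $w$ entries equal to $1$, such that (the last subscript being read modulo $T$): (i) for every $A\in C$ and every integer $1\le t\le T-1$, $\sum_{i_1,\dots,i_n}a_{i_1,\dots,i_n}a_{i_1,\dots,i_n+t}\le\lambda_a$; (ii) for all distinct $A,B\in C$ and every integer $0\le t\le T-1$, $\sum_{i_1,\dots,i_n}a_{i_1,\dots,i_n}b_{i_1,\dots,i_n+t}\le\lambda_c$. The sums run over all index tuples. A code with $\lambda_a=0$ is called ideal. For distinct $i_1,\dots,i_j\in\{1,\dots,n-1\}$, an $(i_1,\dots,i_j)$-section of a codeword is the sub-array obtained by fixing the values of the coordinates numbered $i_1,\dots,i_j$ (all other coordinates, including the last/time coordinate, run over their full ranges). A code is AMOPS$(i_1,\dots,i_j)$ ("at most one pulse per section") if every $(i_1,\dots,i_j)$-section of every codeword contains at most one entry equal to $1$; such a code is automatically ideal. In the nested floor expressions the factors inside the outer factor $\frac N{Tw}$ are indexed by $1,\dots,\lambda$; for $\lambda=0$ they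 reduce to $\lfloor N/(Tw)\rfloor$. *)

theory Defs
  imports Complex_Main "HOL-Library.FuncSet"
begin

text \<open>
  Index tuples \<open>(i\<^sub>1, \<dots>, i\<^sub>n)\<close> are extensional functions on \<open>{1..n}\<close>; coordinate \<open>n\<close> is the
  time coordinate, of range \<open>T\<close>, and only the values of \<open>\<Lambda>\<close> on \<open>{1..n-1}\<close> matter.
\<close>

definition positions :: "nat \<Rightarrow> (nat \<Rightarrow> nat) \<Rightarrow> nat \<Rightarrow> (nat \<Rightarrow> nat) set" where
  "positions n \<Lambda> T = (\<Pi>\<^sub>E s\<in>{1..n}. {..<(\<Lambda>(n := T)) s})"

text \<open>
  Arrays are extensional as well, so that equality of codewords is equality of all entries and
  \<^term>\<open>card C\<close> is the size of a code \<open>C\<close>.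
\<close>

definition binary_arrays :: "nat \<Rightarrow> (nat \<Rightarrow> nat) \<Rightarrow> nat \<Rightarrow> ((nat \<Rightarrow> nat) \<Rightarrow> nat) set" where
  "binary_arrays n \<Lambda> T = positions n \<Lambda> T \<rightarrow>\<^sub>E {0, 1}"

definition time_shift :: "nat \<Rightarrow> nat \<Rightarrow> nat \<Rightarrow> (nat \<Rightarrow> nat) \<Rightarrow> (nat \<Rightarrow> nat)" where
  "time_shift n T t x = x(n := (x n + t) mod T)"

definition ooc ::
  "nat \<Rightarrow> (nat \<Rightarrow> nat) \<Rightarrow> nat \<Rightarrow> nat \<Rightarrow> nat \<Rightarrow> nat \<Rightarrow> ((nat \<Rightarrow> nat) \<Rightarrow> nat) set \<Rightarrow> bool" where
  "ooc n \<Lambda> T w la lc C \<longleftrightarrow>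
     C \<noteq> {} \<and>
     C \<subseteq> binary_arrays n \<Lambda> T \<and>
     (\<forall>A\<in>C. card {x \<in> positions n \<Lambda> T. A x = 1} = w) \<and>
     (\<forall>A\<in>C. \<forall>t\<in>{1..<T}.
        (\<Sum>x\<in>positions n \<Lambda> T. A x * A (time_shift n T t x)) \<le> la) \<and>
     (\<forall>A\<in>C. \<forall>B\<in>C. A \<noteq> B \<longrightarrow> (\<forall>t\<in>{0..<T}.
        (\<Sum>x\<in>positions n \<Lambda> T. A x * B (time_shift n T t x)) \<le> lc))"

text \<open>
  The positions of the section obtained by fixing the coordinates listed in \<open>js\<close> to the
  values given by \<open>v\<close>.
\<close>

definition section_positions ::
  "nat \<Rightarrow> (nat \<Rightarrow> nat) \<Rightarrow> nat \<Rightarrow> nat list \<Rightarrow> (nat \<Rightarrow> nat) \<Rightarrow> (nat \<Rightarrow> nat) set" where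
  "section_positions n \<Lambda> T js v = {x \<in> positions n \<Lambda> T. \<forall>s\<in>set js. x s = v s}"

definition amops ::
  "nat \<Rightarrow> (nat \<Rightarrow> nat) \<Rightarrow> nat \<Rightarrow> nat list \<Rightarrow> ((nat \<Rightarrow> nat) \<Rightarrow> nat) set \<Rightarrow> bool" where
  "amops n \<Lambda> T js C \<longleftrightarrow>
     (\<forall>A\<in>C. \<forall>v \<in> (\<Pi>\<^sub>E s\<in>set js. {..<\<Lambda> s}).
        card {x \<in> section_positions n \<Lambda> T js v. A x = 1} \<le> 1)"

definition amops_oocs ::
  "nat \<Rightarrow> (nat \<Rightarrow> nat) \<Rightarrow> nat \<Rightarrow> nat \<Rightarrow> nat \<Rightarrow> nat \<Rightarrow> nat list \<Rightarrow> ((nat \<Rightarrow> nat) \<Rightarrow> nat) set set" where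
  "amops_oocs n \<Lambda> T w la lc js = {C. ooc n \<Lambda> T w la lc C \<and> amops n \<Lambda> T js C}"

text \<open>The maximum below is over a finite set, and codes are finite.\<close>

lemma finite_binary_arrays: "finite (binary_arrays n \<Lambda> T)"
  unfolding binary_arrays_def positions_def by (intro finite_PiE) auto

lemma finite_amops_oocs: "finite (amops_oocs n \<Lambda> T w la lc js)"
  by (rule finite_subset[of _ "Pow (binary_arrays n \<Lambda> T)"])
     (auto simp: amops_oocs_def ooc_def finite_binary_arrays)

lemma finite_amops_ooc: "C \<in> amops_oocs n \<Lambda> T w la lc js \<Longrightarrow> finite C"
  using finite_binary_arrays by (auto simp: amops_oocs_def ooc_def intro: finite_subset)

definition max_amops_ooc ::
  "nat \<Rightarrow> (nat \<Rightarrow> nat) \<Rightarrow> nat \<Rightarrow> nat \<Rightarrow> nat \<Rightarrow> nat \<Rightarrow> nat list \<Rightarrow> nat" where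
  "max_amops_ooc n \<Lambda> T w la lc js = Max (card ` amops_oocs n \<Lambda> T w la lc js)"

text \<open>
  \<open>nested_floor [x\<^sub>0, \<dots>, x\<^sub>m] = \<lfloor>x\<^sub>0 \<lfloor>x\<^sub>1 \<lfloor>\<dots> \<lfloor>x\<^sub>m\<rfloor> \<dots>\<rfloor>\<rfloor>\<rfloor>\<close>; the value \<open>1\<close> on the empty list makes the
  innermost floor \<open>\<lfloor>x\<^sub>m * 1\<rfloor>\<close>.
\<close>

primrec nested_floor :: "real list \<Rightarrow> int" where
  "nested_floor [] = 1"
| "nested_floor (x # xs) = \<lfloor>x * of_int (nested_floor xs)\<rfloor>"

definition section_bound :: "nat \<Rightarrow> nat \<Rightarrow> nat \<Rightarrow> nat \<Rightarrow> nat \<Rightarrow> int" where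
  "section_bound N T M w l =
     nested_floor (real N / (real T * real w) #
       map (\<lambda>k. real N * (1 - real k / real M) / (real w - real k)) [1..<l+1])"

definition ideal_bound :: "nat \<Rightarrow> nat \<Rightarrow> nat \<Rightarrow> nat \<Rightarrow> int" where
  "ideal_bound N T w l =
     nested_floor (real N / (real T * real w) #
       map (\<lambda>k. (real N - real k * real T) / (real w - real k)) [1..<l+1])"

end

theory Submission
  imports Defs
begin

text \<open>
  The bound is a Johnson bound for packings of partial transversals. Replace each codeword by
  its \<open>T\<close> cyclic time shifts, viewed as sets of positions. A shift preserves the coordinates
  that define the sections, so every shifted codeword is still a \<open>w\<close>-set meeting each of
  the \<open>M\<close> sections at most once. The two correlation conditions together say that any two of
  these \<open>T \<cdot> |C|\<close> sets meet in at most \<open>\<lambda>\<close> points: for shifts of one codeword in none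
  (ideality), for shifts of different codewords in at most \<open>\<lambda>\<close>.

  Let \<open>deg Y\<close> be the number of these sets that contain a given set \<open>Y\<close>. If \<open>|Y| = \<lambda> + 1\<close>, then
  \<open>deg Y \<le> 1\<close>. If \<open>|Y| = k \<le> \<lambda>\<close> and \<open>deg Y > 0\<close>, count the pairs of a set \<open>A \<supseteq> Y\<close> and a point
  \<open>x \<in> A - Y\<close>. Each \<open>A\<close> has \<open>w - k\<close> such points, and none of them lies in the \<open>k\<close> sections that
  \<open>Y\<close> meets, so only \<open>N - k N / M = N (1 - k / M)\<close> points \<open>x\<close> are possible. Hence
  \<open>deg Y \<le> \<lfloor>N (1 - k / M) / (w - k) \<cdot> max deg (Y \<union> {x})\<rfloor>\<close>, and descending from \<open>k = \<lambda>\<close> to \<open>k = 1\<close>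
  bounds the degree of a point by the nested floor (\<open>degree_le_nested_floor\<close>). Counting
  incidences of points with all \<open>T \<cdot> |C|\<close> sets gives the outermost factor \<open>N / (T w)\<close>.

  The comparison with the bound for ideal codes is factorwise, as a section has at least \<open>T\<close>
  points. If \<open>w = M\<close>, each inner factor is \<open>N / M\<close> and the outermost one is \<open>N / (T M)\<close>;
  both are integers, so no floor rounds anything.
\<close>

section \<open>Nested floors\<close>

lemma nested_floor_nonneg: "(\<And>x. x \<in> set xs \<Longrightarrow> 0 \<le> x) \<Longrightarrow> 0 \<le> nested_floor xs"
  by (induction xs) auto

lemma nested_floor_mono:
  assumes "list_all2 (\<lambda>x y. 0 \<le> x \<and> x \<le> y) xs ys"
  shows "0 \<le> nested_floor xs \<and> nested_floor xs \<le> nested_floor ys"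
  using assms
proof (induction rule: list_all2_induct)
  case Nil
  then show ?case by simp
next
  case (Cons x xs y ys)
  then have "x * of_int (nested_floor xs) \<le> y * of_int (nested_floor ys)"
    by (intro mult_mono) auto
  with Cons show ?case by (auto intro: floor_mono)
qed

lemma nested_floor_replicate_of_nat:
  "nested_floor (replicate m (of_nat c)) = int (c ^ m)"
proof (induction m)
  case (Suc m)
  have "real c * of_int (int (c ^ m)) = of_int (int (c ^ Suc m))" by simp
  with Suc show ?case by (metis floor_of_int nested_floor.simps(2) replicate_Suc)
qed simp

section \<open>Packings of partial transversals\<close>

text \<open>
  The fibres of \<open>p\<close> play the role of the sections.
\<close>

lemma card_fibres_of_transversal:
  assumes "finite X" "Y \<subseteq> X" "inj_on p Y"
    and fib: "\<And>y. y \<in> X \<Longrightarrow> card {x \<in> X. p x = p y} = g"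
  shows "card {x \<in> X. p x \<in> p ` Y} = card Y * g"
proof -
  have "{x \<in> X. p x \<in> p ` Y} = (\<Union>y\<in>Y. {x \<in> X. p x = p y})"
    by auto
  also have "card \<dots> = (\<Sum>y\<in>Y. card {x \<in> X. p x = p y})"
    using assms finite_subset[OF assms(2,1)]
    by (intro card_UN_disjoint) (auto dest: inj_onD)
  also have "\<dots> = (\<Sum>y\<in>Y. g)"
    using assms by (intro sum.cong) auto
  finally show ?thesis by simp
qed

lemma card_outside_fibres_of_transversal:
  assumes "finite X" "Y \<subseteq> X" "inj_on p Y"
    and "\<And>y. y \<in> X \<Longrightarrow> card {x \<in> X. p x = p y} = g"
  shows "real (card {x \<in> X. p x \<notin> p ` Y}) = real (card X) - real (card Y) * real g"
proof -
  have "card X = card ({x \<in> X. p x \<in> p ` Y} \<union> {x \<in> X. p x \<notin> p ` Y})"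
    by (rule arg_cong[of _ _ card]) auto
  also have "\<dots> = card {x \<in> X. p x \<in> p ` Y} + card {x \<in> X. p x \<notin> p ` Y}"
    using assms(1) by (intro card_Un_disjoint) auto
  finally show ?thesis
    by (simp add: card_fibres_of_transversal[OF assms])
qed

text \<open>
  The family is indexed, so that the shifts of the codewords can be counted without first
  proving them pairwise distinct.
\<close>

locale transversal_packing =
  fixes X :: "'a set" and p :: "'a \<Rightarrow> 'b" and g :: nat
    and I :: "'i set" and S :: "'i \<Rightarrow> 'a set" and w l :: nat
  assumes finite_X: "finite X" and finite_I: "finite I"
    and fibre: "\<And>y. y \<in> X \<Longrightarrow> card {x \<in> X. p x = p y} = g"
    and block_subset: "\<And>i. i \<in> I \<Longrightarrow> S i \<subseteq> X"
    and card_block: "\<And>i. i \<in> I \<Longrightarrow> card (S i) = w"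
    and transversal: "\<And>i. i \<in> I \<Longrightarrow> inj_on p (S i)"
    and card_Int_block: "\<And>i j. i \<in> I \<Longrightarrow> j \<in> I \<Longrightarrow> i \<noteq> j \<Longrightarrow> card (S i \<inter> S j) \<le> l"
    and less: "l < w"
begin

definition degree :: "'a set \<Rightarrow> nat" where
  "degree Y = card {i \<in> I. Y \<subseteq> S i}"

text \<open>
  With \<open>N = |X|\<close> points in \<open>M\<close> fibres of size \<open>g = N / M\<close>, this is \<open>N (1 - k / M) / (w - k)\<close>.
\<close>

definition factor :: "nat \<Rightarrow> real" where
  "factor k = (real (card X) - real k * real g) / (real w - real k)"

text \<open>
  The \<open>w\<close> points of a block lie in \<open>w\<close> disjoint fibres. For codes this says \<open>w \<le> M\<close>, which makes
  all factors nonnegative.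
\<close>

lemma block_size_times_fibre_le:
  assumes "i \<in> I"
  shows "w * g \<le> card X"
proof -
  have "w * g = card {x \<in> X. p x \<in> p ` S i}"
    using card_fibres_of_transversal[OF finite_X block_subset transversal fibre] card_block assms
    by simp
  also have "\<dots> \<le> card X" using finite_X by (intro card_mono) auto
  finally show ?thesis .
qed

lemma factor_nonneg:
  assumes "I \<noteq> {}" "k \<le> l"
  shows "0 \<le> factor k"
proof -
  have "k * g \<le> w * g" using assms(2) less by simp
  also have "\<dots> \<le> card X" using assms(1) block_size_times_fibre_le by blast
  finally have "real k * real g \<le> real (card X)"
    by (metis of_nat_le_iff of_nat_mult)
  then show ?thesis using assms(2) less by (simp add: factor_def)
qed

text \<open>
  Double counting of the pairs consisting of a block containing \<open>Y\<close> and one of its further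
  points. Transversality confines such a point to the fibres that miss \<open>Y\<close>.
\<close>

lemma degree_double_count:
  assumes "Y \<subseteq> X"
  shows "(w - card Y) * degree Y = (\<Sum>x\<in>{x \<in> X. p x \<notin> p ` Y}. degree (insert x Y))"
proof -
  let ?J = "{i \<in> I. Y \<subseteq> S i}" and ?Z = "{x \<in> X. p x \<notin> p ` Y}"
  have new: "card {x \<in> ?Z. x \<in> S i} = w - card Y" if "i \<in> ?J" for i
  proof -
    have "{x \<in> ?Z. x \<in> S i} = S i - Y"
      using that block_subset[of i] transversal[of i] by (auto dest: inj_onD)
    moreover have "finite Y" using assms finite_X by (rule finite_subset)
    ultimately show ?thesis using that card_block[of i] by (simp add: card_Diff_subset)
  qed
  have "(w - card Y) * degree Y = (\<Sum>i\<in>?J. card {x \<in> ?Z. x \<in> S i})"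
    by (simp only: sum.cong[OF refl new] sum_constant degree_def mult.commute of_nat_id)
  also have "\<dots> = (\<Sum>x\<in>?Z. card {i \<in> ?J. x \<in> S i})"
    using finite_X finite_I by (intro sum_multicount_gen) auto
  also have "{i \<in> ?J. x \<in> S i} = {i \<in> I. insert x Y \<subseteq> S i}" for x
    by auto
  then have "(\<Sum>x\<in>?Z. card {i \<in> ?J. x \<in> S i}) = (\<Sum>x\<in>?Z. degree (insert x Y))"
    by (simp only: degree_def)
  finally show ?thesis .
qed

text \<open>
  The Johnson recursion. It starts at \<open>card Y = l + 1\<close>, where two blocks containing \<open>Y\<close> would
  meet in too many points; this is the value \<open>1\<close> of the empty nested floor.
\<close>

lemma degree_le_nested_floor:
  assumes "I \<noteq> {}" "Y \<subseteq> X" "card Y \<le> l + 1"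
  shows "int (degree Y) \<le> nested_floor (map factor [card Y..<l+1])"
  using assms(2,3)
proof (induction "l + 1 - card Y" arbitrary: Y)
  case 0
  have "i = j" if "i \<in> I" "j \<in> I" "Y \<subseteq> S i" "Y \<subseteq> S j" for i j
  proof (rule ccontr)
    assume "i \<noteq> j"
    have "finite (S i \<inter> S j)" using block_subset[OF that(1)] finite_X finite_subset by blast
    then have "card Y \<le> card (S i \<inter> S j)" using that by (intro card_mono) auto
    with card_Int_block[OF that(1,2) \<open>i \<noteq> j\<close>] 0 show False by simp
  qed
  then have "degree Y \<le> 1"
    unfolding degree_def using finite_I by (simp add: card_le_Suc0_iff_eq)
  with 0 show ?case by simp
next
  case (Suc m)
  let ?k = "card Y"
  let ?D = "nested_floor (map factor [Suc ?k..<l+1])"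
  have k: "?k \<le> l" using Suc.hyps(2) by simp
  have "0 \<le> ?D"
    using factor_nonneg[OF assms(1)] by (intro nested_floor_nonneg) auto
  have unfold: "nested_floor (map factor [?k..<l+1]) = \<lfloor>factor ?k * of_int ?D\<rfloor>"
    using k by (simp add: upt_conv_Cons del: upt_Suc)
  show ?case
  proof (cases "degree Y = 0")
    case True
    have "0 \<le> factor ?k * of_int ?D"
      using \<open>0 \<le> ?D\<close> factor_nonneg[OF assms(1) k] by (intro mult_nonneg_nonneg) (simp_all only: of_int_0_le_iff)
    then show ?thesis by (simp only: unfold True zero_le_floor of_nat_0)
  next
    case False
    let ?Z = "{x \<in> X. p x \<notin> p ` Y}"
    from False have "{i \<in> I. Y \<subseteq> S i} \<noteq> {}"
      unfolding degree_def by (metis card.empty)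
    then obtain i where "i \<in> I" "Y \<subseteq> S i" by blast
    then have inj: "inj_on p Y" using transversal inj_on_subset by blast
    have "finite Y" using Suc.prems(1) finite_X by (rule finite_subset)
    have IH: "real (degree (insert x Y)) \<le> of_int ?D" if "x \<in> ?Z" for x
    proof -
      from that have "x \<notin> Y" by auto
      then have card: "card (insert x Y) = Suc ?k" using \<open>finite Y\<close> by simp
      have "int (degree (insert x Y)) \<le> nested_floor (map factor [card (insert x Y)..<l+1])"
      proof (rule Suc.hyps(1))
        show "m = l + 1 - card (insert x Y)" using Suc.hyps(2) card by simp
        show "insert x Y \<subseteq> X" using that Suc.prems(1) by auto
        show "card (insert x Y) \<le> l + 1" using card k by simp
      qed
      then have "int (degree (insert x Y)) \<le> ?D" by (simp only: card)
      then show ?thesis by linarith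
    qed
    have "(real w - real ?k) * real (degree Y) = real ((w - ?k) * degree Y)"
      using k less by (simp add: of_nat_diff)
    also have "\<dots> = (\<Sum>x\<in>?Z. real (degree (insert x Y)))"
      by (simp add: degree_double_count[OF Suc.prems(1)])
    also have "\<dots> \<le> (\<Sum>x\<in>?Z. of_int ?D)" using IH by (rule sum_mono)
    also have "\<dots> = (real (card X) - real ?k * real g) * of_int ?D"
      using card_outside_fibres_of_transversal[OF finite_X Suc.prems(1) inj fibre]
      by simp
    finally have "real (degree Y) \<le> factor ?k * of_int ?D"
      using k less by (simp add: factor_def field_simps)
    then have "int (degree Y) \<le> \<lfloor>factor ?k * of_int ?D\<rfloor>" by (simp add: le_floor_iff)
    then show ?thesis by (simp only: unfold)
  qed
qed

text \<open>
  The last step of the recursion, from points to the empty set, is left without a floor. The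
  family of shifts has \<open>T\<close> members for each codeword, and dividing by \<open>T\<close> before rounding gives
  the outermost factor \<open>N / (T w)\<close> under a single floor.
\<close>

lemma card_packing_bound:
  assumes "I \<noteq> {}"
  shows "real w * real (card I) \<le>
    real (card X) * of_int (nested_floor (map factor [1..<l+1]))"
proof -
  have "real (degree {x}) \<le> of_int (nested_floor (map factor [1..<l+1]))" if "x \<in> X" for x
    using degree_le_nested_floor[OF assms, of "{x}"] that
    by (simp del: upt_Suc)
  then have "(\<Sum>x\<in>X. real (degree {x})) \<le>
      (\<Sum>x\<in>X. of_int (nested_floor (map factor [1..<l+1])))"
    by (rule sum_mono)
  moreover have "w * card I = (\<Sum>x\<in>X. degree {x})"
    using degree_double_count[of "{}"] by (simp add: degree_def)
  then have "real w * real (card I) = (\<Sum>x\<in>X. real (degree {x}))"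
    by (metis of_nat_mult of_nat_sum)
  ultimately show ?thesis by simp
qed

end

section \<open>Positions, sections and time shifts\<close>

lemma finite_positions: "finite (positions n \<Lambda> T)"
  unfolding positions_def by (intro finite_PiE) auto

lemma card_positions:
  assumes "n \<ge> 1"
  shows "card (positions n \<Lambda> T) = (\<Prod>s\<in>{1..n-1}. \<Lambda> s) * T"
proof -
  have "{1..n} = insert n {1..n-1}" using assms by auto
  moreover have "(\<Prod>s\<in>{1..n-1}. (\<Lambda>(n := T)) s) = (\<Prod>s\<in>{1..n-1}. \<Lambda> s)"
    using assms by (intro prod.cong) auto
  moreover have "n \<notin> {1..n-1}" using assms by auto
  ultimately show ?thesis
    by (simp add: positions_def card_PiE mult.commute del: atLeastAtMost_iff)
qed

lemma card_section:
  assumes "J \<subseteq> {1..n-1}" "n \<ge> 1" "y \<in> positions n \<Lambda> T"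
  shows "card {x \<in> positions n \<Lambda> T. restrict x J = restrict y J}
    = (\<Prod>s\<in>{1..n-1} - J. \<Lambda> s) * T"
proof -
  have eq: "restrict x J = restrict y J \<longleftrightarrow> (\<forall>s\<in>J. x s = y s)" for x
    by (auto simp: restrict_def fun_eq_iff)
  have sub: "J \<subseteq> {1..n}" using assms(1) by force
  have "{x \<in> positions n \<Lambda> T. restrict x J = restrict y J} =
      (\<Pi>\<^sub>E s\<in>{1..n}. if s \<in> J then {y s} else {..<(\<Lambda>(n := T)) s})" (is "?L = ?R")
  proof (intro equalityI subsetI)
    fix x assume "x \<in> ?L"
    then have x: "x \<in> (\<Pi>\<^sub>E s\<in>{1..n}. {..<(\<Lambda>(n := T)) s})" "\<And>s. s \<in> J \<Longrightarrow> x s = y s"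
      by (simp_all only: eq positions_def mem_Collect_eq)
    show "x \<in> ?R"
    proof (rule PiE_I)
      show "x s \<in> (if s \<in> J then {y s} else {..<(\<Lambda>(n := T)) s})" if "s \<in> {1..n}" for s
        using x(2) PiE_mem[OF x(1) that] by simp
    qed (rule PiE_arb[OF x(1)])
  next
    fix x assume x: "x \<in> ?R"
    have J: "x s = y s" if "s \<in> J" for s
      using PiE_mem[OF x, of s] sub that by auto
    have "x \<in> positions n \<Lambda> T"
      unfolding positions_def
    proof (rule PiE_I)
      show "x s \<in> {..<(\<Lambda>(n := T)) s}" if "s \<in> {1..n}" for s
        using PiE_mem[OF x that] PiE_mem[OF assms(3)[unfolded positions_def] that] J[of s]
        by (cases "s \<in> J") simp_all
    qed (rule PiE_arb[OF x])
    with J show "x \<in> ?L" unfolding eq mem_Collect_eq by blast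
  qed
  then have "card {x \<in> positions n \<Lambda> T. restrict x J = restrict y J} =
      (\<Prod>s\<in>{1..n}. card (if s \<in> J then {y s} else {..<(\<Lambda>(n := T)) s}))"
    by (simp only: card_PiE finite_atLeastAtMost)
  also have "\<dots> = (\<Prod>s\<in>{1..n}. if s \<in> J then 1 else (\<Lambda>(n := T)) s)"
    by (rule prod.cong) auto
  also have "\<dots> = (\<Prod>s\<in>{1..n} - J. (\<Lambda>(n := T)) s)"
    by (rule prod.mono_neutral_cong_right) auto
  also have "{1..n} - J = insert n ({1..n-1} - J)" using assms(1,2) by force
  also have "(\<Prod>s\<in>\<dots>. (\<Lambda>(n := T)) s) = T * (\<Prod>s\<in>{1..n-1} - J. (\<Lambda>(n := T)) s)"
    using assms(2) by (subst prod.insert) auto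
  also have "(\<Prod>s\<in>{1..n-1} - J. (\<Lambda>(n := T)) s) = (\<Prod>s\<in>{1..n-1} - J. \<Lambda> s)"
    using assms(2) by (intro prod.cong) auto
  finally show ?thesis by (simp only: mult.commute)
qed

lemma time_shift_in_positions:
  assumes "n \<ge> 1" "T > 0" "x \<in> positions n \<Lambda> T"
  shows "time_shift n T t x \<in> positions n \<Lambda> T"
  using assms unfolding positions_def time_shift_def
  by (auto simp: PiE_iff extensional_def)

lemma time_shift_time_shift:
  "time_shift n T s (time_shift n T t x) = time_shift n T (t + s) x"
  by (simp add: time_shift_def mod_add_left_eq add.assoc)

lemma time_shift_period:
  assumes "n \<ge> 1" "x \<in> positions n \<Lambda> T" "t mod T = 0"
  shows "time_shift n T t x = x"
proof -
  have "x n < T"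
    using PiE_mem[OF assms(2)[unfolded positions_def], of n] assms(1) by simp
  moreover have "(x n + t) mod T = x n mod T"
    using assms(3) by (metis add.right_neutral mod_add_right_eq)
  ultimately show ?thesis by (simp add: time_shift_def)
qed

lemma bij_betw_time_shift:
  assumes "n \<ge> 1" "T > 0" "t < T"
  shows "bij_betw (time_shift n T t) (positions n \<Lambda> T) (positions n \<Lambda> T)"
  by (rule bij_betw_byWitness[where f' = "time_shift n T (T - t)"])
     (use assms in \<open>auto simp: time_shift_time_shift time_shift_period time_shift_in_positions\<close>)

section \<open>The packing formed by the shifted codewords\<close>

definition shifted_support ::
  "nat \<Rightarrow> (nat \<Rightarrow> nat) \<Rightarrow> nat \<Rightarrow> ((nat \<Rightarrow> nat) \<Rightarrow> nat) \<times> nat \<Rightarrow> (nat \<Rightarrow> nat) set" where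
  "shifted_support n \<Lambda> T = (\<lambda>(A, t). {x \<in> positions n \<Lambda> T. A (time_shift n T t x) = 1})"

lemma card_Collect_bij_betw:
  assumes "bij_betw f X X"
  shows "card {x \<in> X. P (f x)} = card {y \<in> X. P y}"
  by (rule bij_betw_same_card[of f], rule bij_betw_subset[OF assms])
     (use assms in \<open>auto simp: bij_betw_def\<close>)

text \<open>
  Substituting \<open>time_shift n T t x\<close> for the summation index turns the intersection into a
  correlation sum with the relative delay \<open>t' - t\<close>, written as \<open>t' + (T - t)\<close> to avoid
  truncated subtraction.
\<close>

lemma card_shifted_support_Int:
  assumes "n \<ge> 1" "T > 0" "t < T"
    and A: "A \<in> binary_arrays n \<Lambda> T" and B: "B \<in> binary_arrays n \<Lambda> T"
  shows "card (shifted_support n \<Lambda> T (A, t) \<inter> shifted_support n \<Lambda> T (B, t')) =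
    (\<Sum>x\<in>positions n \<Lambda> T. A x * B (time_shift n T ((t' + (T - t)) mod T) x))"
proof -
  let ?X = "positions n \<Lambda> T" and ?d = "(t' + (T - t)) mod T"
  have shift: "time_shift n T ?d (time_shift n T t x) = time_shift n T t' x" for x
  proof -
    have "(t + ?d) mod T = (t + (t' + (T - t))) mod T" by (rule mod_add_right_eq)
    also have "t + (t' + (T - t)) = t' + T" using assms(3) by simp
    finally have "(t + ?d) mod T = t' mod T" by simp
    then have "(x n + (t + ?d)) mod T = (x n + t') mod T"
      by (metis mod_add_right_eq)
    then show ?thesis unfolding time_shift_time_shift by (simp add: time_shift_def)
  qed
  have zero_one: "A x \<in> {0, 1}" "B x \<in> {0, 1}" if "x \<in> ?X" for x
    using that A B unfolding binary_arrays_def by (auto simp: PiE_iff)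
  have "card (shifted_support n \<Lambda> T (A, t) \<inter> shifted_support n \<Lambda> T (B, t')) =
      card {x \<in> ?X. A (time_shift n T t x) = 1 \<and> B (time_shift n T ?d (time_shift n T t x)) = 1}"
    unfolding shift by (rule arg_cong[of _ _ card]) (auto simp: shifted_support_def)
  also have "\<dots> = card {x \<in> ?X. A x = 1 \<and> B (time_shift n T ?d x) = 1}"
    by (rule card_Collect_bij_betw[OF bij_betw_time_shift[OF assms(1-3)]])
  also have "\<dots> = (\<Sum>x\<in>?X. if A x = 1 \<and> B (time_shift n T ?d x) = 1 then 1 else 0)"
    by (simp only: card_eq_sum sum.inter_filter[OF finite_positions])
  also have "\<dots> = (\<Sum>x\<in>?X. A x * B (time_shift n T ?d x))"
  proof (rule sum.cong[OF refl])
    fix x assume x: "x \<in> ?X"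
    then have "time_shift n T ?d x \<in> ?X" using assms(1,2) by (rule time_shift_in_positions[rotated 2])
    with zero_one(1)[OF x] zero_one(2) show
      "(if A x = 1 \<and> B (time_shift n T ?d x) = 1 then 1 else 0) = A x * B (time_shift n T ?d x)"
      by fastforce
  qed
  finally show ?thesis .
qed

lemma relative_delay_eq_0_iff:
  fixes t t' T :: nat
  assumes "t < T" "t' < T"
  shows "(t' + (T - t)) mod T = 0 \<longleftrightarrow> t = t'"
proof (cases "t \<le> t'")
  case True
  then have "t' + (T - t) = (t' - t) + T" using assms by simp
  also have "\<dots> mod T = t' - t" using assms by simp
  finally show ?thesis using True by auto
next
  case False
  with assms show ?thesis by simp
qed

lemma oocD:
  assumes "ooc n \<Lambda> T w la lc C"
  shows "C \<noteq> {}"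
    and "A \<in> C \<Longrightarrow> A \<in> binary_arrays n \<Lambda> T"
    and "A \<in> C \<Longrightarrow> card {x \<in> positions n \<Lambda> T. A x = 1} = w"
    and "A \<in> C \<Longrightarrow> t \<in> {1..<T} \<Longrightarrow>
      (\<Sum>x\<in>positions n \<Lambda> T. A x * A (time_shift n T t x)) \<le> la"
    and "A \<in> C \<Longrightarrow> B \<in> C \<Longrightarrow> A \<noteq> B \<Longrightarrow> t \<in> {0..<T} \<Longrightarrow>
      (\<Sum>x\<in>positions n \<Lambda> T. A x * B (time_shift n T t x)) \<le> lc"
  using assms unfolding ooc_def by blast+

text \<open>
  Time shifts preserve the coordinates in \<open>js\<close>, as time is not among them, so one-pulse-per-section passes from codewords to their shifts. Two shifts of the same
  codeword have a nonzero relative delay and are disjoint by ideality; for different codewords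
  any relative delay is covered by the cross-correlation bound.
\<close>

lemma transversal_packing_shifted_support:
  assumes "n \<ge> 1" "T > 0" "l < w" and J: "set js \<subseteq> {1..n-1}"
    and C: "C \<in> amops_oocs n \<Lambda> T w 0 l js"
  shows "transversal_packing (positions n \<Lambda> T) (\<lambda>x. restrict x (set js))
    ((\<Prod>s\<in>{1..n-1} - set js. \<Lambda> s) * T) (C \<times> {..<T}) (shifted_support n \<Lambda> T) w l"
proof
  let ?X = "positions n \<Lambda> T"
  have ooc: "ooc n \<Lambda> T w 0 l C" and am: "amops n \<Lambda> T js C"
    using C by (auto simp: amops_oocs_def)
  show "finite ?X" by (rule finite_positions)
  show "finite (C \<times> {..<T})" using finite_amops_ooc[OF C] by simp
  show "card {x \<in> ?X. restrict x (set js) = restrict y (set js)} =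
      (\<Prod>s\<in>{1..n-1} - set js. \<Lambda> s) * T" if "y \<in> ?X" for y
    using J assms(1) that by (rule card_section)
  show "l < w" by fact
  show "shifted_support n \<Lambda> T i \<subseteq> ?X" for i
    by (auto simp: shifted_support_def)
  show "card (shifted_support n \<Lambda> T i) = w" if i_in: "i \<in> C \<times> {..<T}" for i
  proof -
    obtain A t where i: "i = (A, t)" "A \<in> C" "t < T" using i_in by (cases i) auto
    have "card {x \<in> ?X. A (time_shift n T t x) = 1} = card {x \<in> ?X. A x = 1}"
      by (rule card_Collect_bij_betw[OF bij_betw_time_shift[OF assms(1,2) i(3)]])
    then show ?thesis using oocD(3)[OF ooc i(2)] unfolding shifted_support_def i(1) by simp
  qed
  show "inj_on (\<lambda>x. restrict x (set js)) (shifted_support n \<Lambda> T i)" if i_in: "i \<in> C \<times> {..<T}" for i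
  proof (rule inj_onI)
    fix x y
    assume x: "x \<in> shifted_support n \<Lambda> T i" and y: "y \<in> shifted_support n \<Lambda> T i"
      and eq: "restrict x (set js) = restrict y (set js)"
    obtain A t where i: "i = (A, t)" "A \<in> C" "t < T" using i_in by (cases i) auto
    let ?v = "restrict x (set js)"
    let ?P = "{z \<in> section_positions n \<Lambda> T js ?v. A z = 1}"
    have X: "x \<in> ?X" "y \<in> ?X" using x y by (auto simp: shifted_support_def i)
    have notin: "n \<notin> set js" using J assms(1) by auto
    have "?v \<in> (\<Pi>\<^sub>E s\<in>set js. {..<\<Lambda> s})"
    proof (rule restrict_PiE_iff[THEN iffD2], rule ballI)
      fix s assume s: "s \<in> set js"
      then have "s \<in> {1..n}" "s \<noteq> n" using J notin by force+
      with PiE_mem[OF X(1)[unfolded positions_def], of s] show "x s \<in> {..<\<Lambda> s}" by simp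
    qed
    then have "card ?P \<le> 1"
      by (rule bspec[OF bspec[OF am[unfolded amops_def] i(2)]])
    then have card_P: "card ?P \<le> Suc 0" by simp
    have "finite ?P"
      using finite_positions by (auto simp: section_positions_def)
    have at_P: "time_shift n T t z \<in> ?P"
      if "z \<in> shifted_support n \<Lambda> T i" "restrict z (set js) = ?v" for z
    proof -
      have "z s = x s" if "s \<in> set js" for s
        using fun_cong[OF \<open>restrict z (set js) = ?v\<close>, of s] that by simp
      with notin have "\<forall>s\<in>set js. time_shift n T t z s = ?v s"
        by (auto simp: time_shift_def)
      with that(1) assms(1,2) show ?thesis
        by (auto simp: section_positions_def shifted_support_def i time_shift_in_positions)
    qed
    have "time_shift n T t x = time_shift n T t y"
      using card_le_Suc0_iff_eq[THEN iffD1, OF \<open>finite ?P\<close> card_P]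
        at_P[OF x refl] at_P[OF y eq[symmetric]] by blast
    with bij_betw_imp_inj_on[OF bij_betw_time_shift[OF assms(1,2) i(3)]] show "x = y"
      using X by (rule inj_onD)
  qed
  show "card (shifted_support n \<Lambda> T i \<inter> shifted_support n \<Lambda> T j) \<le> l"
    if ij: "i \<in> C \<times> {..<T}" "j \<in> C \<times> {..<T}" "i \<noteq> j" for i j
  proof -
    obtain A t B t' where i: "i = (A, t)" "A \<in> C" "t < T" and j: "j = (B, t')" "B \<in> C" "t' < T"
      using ij(1,2) by (cases i, cases j) auto
    let ?d = "(t' + (T - t)) mod T"
    have d: "?d < T" using assms(2) by simp
    have "(\<Sum>x\<in>?X. A x * B (time_shift n T ?d x)) \<le> l"
    proof (cases "A = B")
      case True
      then have "?d \<noteq> 0" using ij(3) i j relative_delay_eq_0_iff by auto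
      with d have "?d \<in> {1..<T}" by auto
      with oocD(4)[OF ooc i(2)] have "(\<Sum>x\<in>?X. A x * A (time_shift n T ?d x)) \<le> 0"
        by blast
      with True show ?thesis by simp
    next
      case False
      from d have "?d \<in> {0..<T}" by simp
      with oocD(5)[OF ooc i(2) j(2) False] show ?thesis by blast
    qed
    moreover have "A \<in> binary_arrays n \<Lambda> T" "B \<in> binary_arrays n \<Lambda> T"
      using oocD(2)[OF ooc] i(2) j(2) by blast+
    ultimately show ?thesis
      unfolding i j using card_shifted_support_Int[OF assms(1,2) i(3)] by simp
  qed
qed

section \<open>The bounds\<close>

lemma section_factor_eq:
  assumes "N = M * g" "M > 0"
  shows "real N * (1 - real k / real M) = real N - real k * real g"
  using assms by (simp add: field_simps)

lemma card_le_section_bound: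
  assumes "n \<ge> 1" "T > 0" "l < w" "set js \<subseteq> {1..n-1}"
    and C: "C \<in> amops_oocs n \<Lambda> T w 0 l js"
    and N: "N = (\<Prod>s\<in>{1..n-1}. \<Lambda> s) * T" "N = M * g" "M > 0"
    and g: "g = (\<Prod>s\<in>{1..n-1} - set js. \<Lambda> s) * T"
  shows "int (card C) \<le> section_bound N T M w l" and "w * g \<le> N"
proof -
  interpret transversal_packing "positions n \<Lambda> T" "\<lambda>x. restrict x (set js)" g
    "C \<times> {..<T}" "shifted_support n \<Lambda> T" w l
    unfolding g using assms(1-5) by (rule transversal_packing_shifted_support)
  have cardX: "card (positions n \<Lambda> T) = N" using card_positions[OF assms(1)] N by simp
  have ne: "C \<times> {..<T} \<noteq> {}"
    using C assms(2) by (auto simp: amops_oocs_def dest: oocD(1))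
  then obtain i where "i \<in> C \<times> {..<T}" by blast
  from block_size_times_fibre_le[OF this] show "w * g \<le> N" by (simp add: cardX)
  have factors: "map (\<lambda>k. real N * (1 - real k / real M) / (real w - real k)) [1..<l+1] =
      map factor [1..<l+1]"
    by (simp add: factor_def cardX section_factor_eq[OF N(2,3)])
  have "(real T * real w) * real (card C) \<le>
      real N * of_int (nested_floor (map factor [1..<l+1]))"
    using card_packing_bound[OF ne] by (simp add: cardX card_cartesian_product mult_ac)
  then have "real (card C) \<le>
      real N / (real T * real w) * of_int (nested_floor (map factor [1..<l+1]))"
    using assms(2,3) by (simp add: field_simps)
  then show "int (card C) \<le> section_bound N T M w l"
    unfolding section_bound_def factors nested_floor.simps by (simp add: le_floor_iff)
qed

text \<open>
  A factor of the section bound removes \<open>k\<close> whole sections of size \<open>g\<close>, one of the ideal bound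
  only \<open>k\<close> time lines of size \<open>T\<close>. The factors are
  nonnegative as \<open>k < w \<le> M\<close>, so the nested floors are monotone in them.
\<close>

lemma section_bound_le_ideal_bound:
  assumes "N = M * g" "M > 0" "T \<le> g" "w \<le> M" "l < w"
  shows "section_bound N T M w l \<le> ideal_bound N T w l"
proof -
  have "0 \<le> real N * (1 - real k / real M) / (real w - real k) \<and>
      real N * (1 - real k / real M) / (real w - real k) \<le>
      (real N - real k * real T) / (real w - real k)" if "k \<le> l" for k
  proof
    show "0 \<le> real N * (1 - real k / real M) / (real w - real k)"
      using that assms by simp
    have "real N * (1 - real k / real M) \<le> real N - real k * real T"
      unfolding section_factor_eq[OF assms(1,2)]
      using assms(3) by (simp add: mult_left_mono)
    then show "real N * (1 - real k / real M) / (real w - real k) \<le>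
      (real N - real k * real T) / (real w - real k)"
      using that assms by (intro divide_right_mono) auto
  qed
  then show ?thesis
    unfolding section_bound_def ideal_bound_def
    by (intro nested_floor_mono[THEN conjunct2])
       (auto simp: list_all2_map1 list_all2_map2 list_all2_same simp del: upt_Suc)
qed

text \<open>
  For \<open>w = M\<close> the numerator \<open>N - k g = (M - k) g\<close> cancels against \<open>w - k\<close>.
\<close>

lemma section_bound_extremal:
  assumes "N = M * g" "M > 0" "T > 0" "g = P * T" "l < M"
  shows "section_bound N T M M l = int (P * g ^ l)"
proof -
  have "real N * (1 - real k / real M) / (real M - real k) = real g" if "k \<le> l" for k
    using that assms(1,2,5) by (simp add: field_simps)
  then have "map (\<lambda>k. real N * (1 - real k / real M) / (real M - real k)) [1..<l+1] =
      map (\<lambda>_. real g) [1..<l+1]"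
    by (intro map_cong refl) (auto simp del: upt_Suc)
  also have "\<dots> = replicate l (real g)"
    by (simp add: map_replicate_const del: upt_Suc)
  finally have "section_bound N T M M l = \<lfloor>real N / (real T * real M) * of_int (int (g ^ l))\<rfloor>"
    unfolding section_bound_def by (simp only: nested_floor.simps nested_floor_replicate_of_nat)
  also have "real N / (real T * real M) * of_int (int (g ^ l)) = of_int (int (P * g ^ l))"
    using assms(1-4) by simp
  finally show ?thesis by (simp only: floor_of_int)
qed

theorem theorem1p7:
  fixes n T w l N :: nat and \<Lambda> :: "nat \<Rightarrow> nat"
  assumes "n \<ge> 2"
    and "\<forall>s\<in>{1..n-1}. \<Lambda> s > 0" and "T > 0" and "w > 0"
    and "l < w"
    and "N = (\<Prod>s\<in>{1..n-1}. \<Lambda> s) * T"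
  shows
    "(\<forall>js M. js \<noteq> [] \<and> distinct js \<and> set js \<subseteq> {1..n-1} \<and> M = (\<Prod>i\<leftarrow>js. \<Lambda> i) \<and>
        amops_oocs n \<Lambda> T w 0 l js \<noteq> {} \<longrightarrow>
          int (max_amops_ooc n \<Lambda> T w 0 l js) \<le> section_bound N T M w l \<and>
          section_bound N T M w l \<le> ideal_bound N T w l \<and>
          (w = M \<longrightarrow>
             real_of_int (section_bound N T M w l) = real N ^ (l+1) / (real T * real M ^ (l+1)))) \<and>
     (\<forall>i\<in>{1..n-1}. amops_oocs n \<Lambda> T w 0 l [i] \<noteq> {} \<longrightarrow>
          int (max_amops_ooc n \<Lambda> T w 0 l [i]) \<le> section_bound N T (\<Lambda> i) w l \<and>
          (w = \<Lambda> i \<longrightarrow>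
             section_bound N T (\<Lambda> i) w l = int (T ^ l * (\<Prod>j\<in>{1..n-1} - {i}. \<Lambda> j ^ (l+1)))))"
proof -
  have pos: "\<Lambda> s > 0" if "s \<in> {1..n-1}" for s using assms(2) that by blast
  have n: "n \<ge> 1" using assms(1) by simp
  have main: "int (max_amops_ooc n \<Lambda> T w 0 l js) \<le> section_bound N T M w l \<and>
      section_bound N T M w l \<le> ideal_bound N T w l \<and>
      (w = M \<longrightarrow> section_bound N T M w l =
        int ((\<Prod>s\<in>{1..n-1} - set js. \<Lambda> s) * ((\<Prod>s\<in>{1..n-1} - set js. \<Lambda> s) * T) ^ l)) \<and>
      N = M * ((\<Prod>s\<in>{1..n-1} - set js. \<Lambda> s) * T) \<and> M > 0"
    if js: "distinct js" "set js \<subseteq> {1..n-1}" "M = (\<Prod>i\<leftarrow>js. \<Lambda> i)"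
      and ex: "amops_oocs n \<Lambda> T w 0 l js \<noteq> {}" for js M
  proof -
    define P where "P = (\<Prod>s\<in>{1..n-1} - set js. \<Lambda> s)"
    have M: "M = (\<Prod>s\<in>set js. \<Lambda> s)"
      using js by (simp add: prod.distinct_set_conv_list)
    have "M > 0" unfolding M using js(2) pos by (intro prod_pos) auto
    have "P > 0" unfolding P_def using pos by (intro prod_pos) auto
    have N: "N = M * (P * T)"
      unfolding assms(6) M P_def
      by (subst prod.subset_diff[OF js(2)]) (simp_all add: mult_ac)
    let ?O = "amops_oocs n \<Lambda> T w 0 l js"
    have bound: "int (card C) \<le> section_bound N T M w l" "w * (P * T) \<le> N" if "C \<in> ?O" for C
      using card_le_section_bound[OF n assms(3,5) js(2) that assms(6) N \<open>M > 0\<close>]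
      by (simp_all add: P_def)
    have "Max (card ` ?O) \<in> card ` ?O"
      using ex by (intro Max_in) (auto simp: finite_amops_oocs)
    then have "int (max_amops_ooc n \<Lambda> T w 0 l js) \<le> section_bound N T M w l"
      using bound(1) by (auto simp: max_amops_ooc_def)
    moreover have "w \<le> M"
      using ex bound(2) \<open>P > 0\<close> assms(3) by (auto simp: N)
    then have "section_bound N T M w l \<le> ideal_bound N T w l"
      using N \<open>M > 0\<close> \<open>P > 0\<close> assms(5)
      by (intro section_bound_le_ideal_bound[where g = "P * T"]) auto
    moreover have "section_bound N T M w l = int (P * (P * T) ^ l)" if "w = M"
      using section_bound_extremal[OF N \<open>M > 0\<close> assms(3) refl] assms(5) that by simp
    ultimately show ?thesis using N \<open>M > 0\<close> by (simp add: P_def)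
  qed
  show ?thesis
  proof (intro conjI allI ballI impI; (elim conjE)?)
    fix js M
    assume js: "distinct js" "set js \<subseteq> {1..n-1}" "M = (\<Prod>i\<leftarrow>js. \<Lambda> i)"
      and ex: "amops_oocs n \<Lambda> T w 0 l js \<noteq> {}"
    note m = main[OF js ex]
    from m show "int (max_amops_ooc n \<Lambda> T w 0 l js) \<le> section_bound N T M w l" by blast
    from m show "section_bound N T M w l \<le> ideal_bound N T w l" by blast
    assume "w = M"
    define P where "P = (\<Prod>s\<in>{1..n-1} - set js. \<Lambda> s)"
    from m \<open>w = M\<close> have b: "section_bound N T M w l = int (P * (P * T) ^ l)"
      and N: "N = M * (P * T)" and "M > 0"
      unfolding P_def by blast+
    have "real N ^ (l+1) / (real T * real M ^ (l+1)) = real P * (real P * real T) ^ l"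
      unfolding N using \<open>M > 0\<close> assms(3) by (simp add: field_simps power_mult_distrib)
    with b show "real_of_int (section_bound N T M w l) =
        real N ^ (l+1) / (real T * real M ^ (l+1))"
      by simp
  next
    fix i
    assume i: "i \<in> {1..n-1}" and ex: "amops_oocs n \<Lambda> T w 0 l [i] \<noteq> {}"
    have m: "distinct [i]" "set [i] \<subseteq> {1..n-1}" "\<Lambda> i = (\<Prod>i\<leftarrow>[i]. \<Lambda> i)"
      using i by auto
    note m = main[OF m ex]
    from m show "int (max_amops_ooc n \<Lambda> T w 0 l [i]) \<le> section_bound N T (\<Lambda> i) w l" by blast
    assume "w = \<Lambda> i"
    define P where "P = (\<Prod>s\<in>{1..n-1} - set [i]. \<Lambda> s)"
    from m \<open>w = \<Lambda> i\<close> have "section_bound N T (\<Lambda> i) w l = int (P * (P * T) ^ l)"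
      unfolding P_def by blast
    also have "P * (P * T) ^ l = T ^ l * P ^ (l+1)"
      by (simp add: power_mult_distrib mult_ac)
    also have "P ^ (l+1) = (\<Prod>j\<in>{1..n-1} - {i}. \<Lambda> j ^ (l+1))"
      unfolding P_def by (simp only: prod_power_distrib list.set)
    finally show "section_bound N T (\<Lambda> i) w l =
        int (T ^ l * (\<Prod>j\<in>{1..n-1} - {i}. \<Lambda> j ^ (l+1)))" .
  qed
qed

end
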